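(* Let $\{(x_k,x_k^* )\}_{k\ge0}$ be generated by the stochastic block Bregman projection (SBBP) method with the decreasing mirror stochastic Polyak stepsize (DecmSPS) $t_k$, under the sampling rule described in the context, where $\{\lambda_k\}$ is nonincreasing with $0<\lambda_k\le1$. Fix $\hat x\in\bar X$ and $K\ge1$, let $D<\infty$ be the maximum of $D_\psi^{x_k^*}(x_k,\hat x)$ over $0\le k\le K-1$ and over all realizations of the random samples, and let $\bar x_K=\frac1K\sum_{k=0}^{K-1}x_k$ and $\tilde L=\min\left\{\frac{\mu}{2L_{\max}},\frac{\gamma_b}{\lambda_0}\right\}$. (a) In the interpolated case ($\sigma_\tau^2=0$), with $\lambda_k=\frac1c$, $k\in\mathbb{N}$, $c\ge1$, $$\mathbb{E}[F(\bar x_K)-\bar F]\le\frac{2Dc}{K\tilde L}.$$ (b) In the non-interpolated case ($\sigma_\tau^2>0$), with $\lambda_k=\frac{1}{c\sqrt{k+1}}$, $k\in\mathbb{N}$, $c>0$ (subject to the requirement $0<\lambda_k\le1$ above), $$\mathbb{E}[F(\bar x_K)-\bar F]\le\frac{2cD/\tilde L+2\sigma_\tau^2/c}{\sqrt K}.$$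
   Context: Notation: $[m]=\{1,\dots,m\}$; $\mathbb{N}$ includes $0$; $\|\cdot\|$ is the Euclidean norm. Problem data: $\psi:\mathbb{R}^n\to\mathbb{R}$ is $\mu$-strongly convex ($\mu>0$); each $f_i:\mathbb{R}^n\to\mathbb{R}$, $i\in[m]$, is convex and differentiable with $L_i$-Lipschitz gradient, $L_i>0$; $L_{\max}=\max_{i\in[m]}L_i$; $F(x)=\frac1m\sum_{i=1}^mf_i(x)$; $\bar F=\min_{x\in\mathbb{R}^n}F(x)$ and $\bar X=\arg\min_{x\in\mathbb{R}^n}F(x)$ is nonempty. $\psi^*$ is the Fenchel conjugate of $\psi$ (differentiable with $1/\mu$-Lipschitz gradient). For $x^*\in\partial\psi(x)$, $D_\psi^{x^*}(x,y)=\psi(y)-\psi(x)-\langle x^*,y-x\rangle$. Sampling rule: fix $\tau\in\{1,\dots,m\}$. At each iteration $k\ge0$ a random subset $J_k\subset[m]$ with $|J_k|=\tau$ is drawn from a fixed distribution with $\mathbf P(i\in J_k)=\tau/m$ for all $i\in[m]$, independently of $J_0,\dots,J_{k-1}$; weights are $w_{i,k}=w_i=1/\tau$, $i\in J_k$. SBBP method: $x_0\in\mathbb{R}^n$, $x_0^*\in\partial\psi(x_0)$ and $$x_{k+1}^*=x_k^*-t_k\sum_{i\in J_k}w_{i,k}\nabla f_i(x_k),\qquad x_{k+1}=\nabla\psi^*(x_{k+1}^* ).$$ DecmSPS: for each $J$ let $l_J^*\in\mathbb{R}$ be any lower bound with $l_J^*\le\inf_{x\in\mathbb{R}^n}\sum_{i\in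 J}w_if_i(x)$. With a nonincreasing positive sequence $\{\lambda_k\}_{k\ge0}$, $\lambda_{-1}=\lambda_0$ and $t_{-1}=\gamma_b>0$, $$t_k=\lambda_k\min\left\{\mu\cdot\frac{\sum_{i\in J_k}w_{i,k}f_i(x_k)-l_{J_k}^*}{\|\sum_{i\in J_k}w_{i,k}\nabla f_i(x_k)\|^2},\ \frac{t_{k-1}}{\lambda_{k-1}}\right\},\quad k\ge0,$$ where the first entry of the minimum is read as $+\infty$ if its denominator is zero. Noise constant: for $\hat x\in\bar X$, $\sigma_\tau^2=\mathbb{E}\left[\sum_{i\in J}w_if_i(\hat x)-l_J^*\right]$, where $J$ has the sampling distribution (the value does not depend on the choice of $\hat x\in\bar X$). *)

theory Defs
  imports "HOL-Probability.Probability"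
begin

section \<open>Convex analysis\<close>

definition strongly_convex :: "real \<Rightarrow> ('a::real_inner \<Rightarrow> real) \<Rightarrow> bool" where
  "strongly_convex \<mu> \<psi> \<longleftrightarrow>
    (\<forall>x y. \<forall>u\<in>{0..1}. \<psi> (u *\<^sub>R x + (1 - u) *\<^sub>R y)
       \<le> u * \<psi> x + (1 - u) * \<psi> y - \<mu> / 2 * u * (1 - u) * (norm (x - y))\<^sup>2)"

definition subdifferential :: "('a::real_inner \<Rightarrow> real) \<Rightarrow> 'a \<Rightarrow> 'a set" where
  "subdifferential \<psi> x = {v. \<forall>y. \<psi> y \<ge> \<psi> x + v \<bullet> (y - x)}"

text \<open>The supremum is taken in the reals, so this is the Fenchel conjugate only where the
  supremum is finite. That is everywhere if \<^term>\<open>\<psi>\<close> is strongly convex on a Euclidean space.\<close>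

definition fenchel_conjugate :: "('a::real_inner \<Rightarrow> real) \<Rightarrow> 'a \<Rightarrow> real" where
  "fenchel_conjugate \<psi> v = (SUP x. v \<bullet> x - \<psi> x)"

definition bregman :: "('a::real_inner \<Rightarrow> real) \<Rightarrow> 'a \<Rightarrow> 'a \<Rightarrow> 'a \<Rightarrow> real" where
  "bregman \<psi> v x y = \<psi> y - \<psi> x - v \<bullet> (y - x)"

text \<open>The value is unspecified where the function is not differentiable.\<close>

definition grad :: "('a::real_inner \<Rightarrow> real) \<Rightarrow> 'a \<Rightarrow> 'a" where
  "grad f x = (THE D. GDERIV f x :> D)"

lemma grad_eqI:
  assumes "GDERIV f x :> D"
  shows "grad f x = D"
  unfolding grad_def
proof (rule the_equality)
  show "GDERIV f x :> D" by (fact assms)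
next
  fix E assume "GDERIV f x :> E"
  then have "(\<lambda>h. h \<bullet> E) = (\<lambda>h. h \<bullet> D)"
    using assms has_derivative_unique unfolding gderiv_def by blast
  then have "(E - D) \<bullet> E = (E - D) \<bullet> D" by meson
  then have "(E - D) \<bullet> (E - D) = 0" by (simp add: inner_diff_right)
  then show "E = D" by simp
qed

section \<open>The finite-sum objective and its blocks\<close>

definition objective :: "nat \<Rightarrow> (nat \<Rightarrow> 'a \<Rightarrow> real) \<Rightarrow> 'a \<Rightarrow> real" where
  "objective m f x = (1 / real m) * (\<Sum>i=1..m. f i x)"

definition minimizers :: "('a \<Rightarrow> real) \<Rightarrow> 'a set" where
  "minimizers F = {x. is_arg_min F (\<lambda>_. True) x}"

definition blocks :: "nat \<Rightarrow> nat \<Rightarrow> nat set set" where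
  "blocks m \<tau> = {J. J \<subseteq> {1..m} \<and> card J = \<tau>}"

text \<open>The weights are \<open>w\<^sub>i = 1 / \<tau>\<close> for all \<open>i\<close>.\<close>

definition block_fun :: "nat \<Rightarrow> (nat \<Rightarrow> 'a \<Rightarrow> real) \<Rightarrow> nat set \<Rightarrow> 'a \<Rightarrow> real" where
  "block_fun \<tau> f J x = (\<Sum>i\<in>J. (1 / real \<tau>) * f i x)"

definition block_grad ::
    "nat \<Rightarrow> (nat \<Rightarrow> 'a::real_inner \<Rightarrow> real) \<Rightarrow> nat set \<Rightarrow> 'a \<Rightarrow> 'a" where
  "block_grad \<tau> f J x = (\<Sum>i\<in>J. (1 / real \<tau>) *\<^sub>R grad (f i) x)"

text \<open>The noise constant \<open>\<sigma>\<^sub>\<tau>\<^sup>2\<close> itself (not its square root), for the block distribution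
  \<open>p\<close> and the lower bounds \<open>l\<close>.\<close>

definition noise_sq ::
    "nat set pmf \<Rightarrow> nat \<Rightarrow> (nat \<Rightarrow> 'a \<Rightarrow> real) \<Rightarrow> (nat set \<Rightarrow> real) \<Rightarrow> 'a \<Rightarrow> real" where
  "noise_sq p \<tau> f l xhat = measure_pmf.expectation p (\<lambda>J. block_fun \<tau> f J xhat - l J)"

section \<open>The method along one sequence of blocks\<close>

text \<open>In the following, \<open>S k\<close> is the block used in iteration \<open>k\<close>.\<close>

definition sbbp ::
    "('a::real_inner \<Rightarrow> real) \<Rightarrow> nat \<Rightarrow> (nat \<Rightarrow> 'a \<Rightarrow> real) \<Rightarrow> 'a \<Rightarrow> 'a
      \<Rightarrow> (nat \<Rightarrow> nat set) \<Rightarrow> (nat \<Rightarrow> real) \<Rightarrow> (nat \<Rightarrow> 'a) \<Rightarrow> (nat \<Rightarrow> 'a) \<Rightarrow> bool" where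
  "sbbp \<psi> \<tau> f x0 xs0 S t x xs \<longleftrightarrow>
    x 0 = x0 \<and> xs 0 = xs0 \<and>
    (\<forall>k. xs (Suc k) = xs k - t k *\<^sub>R block_grad \<tau> f (S k) (x k) \<and>
         x (Suc k) = grad (fenchel_conjugate \<psi>) (xs (Suc k)))"

text \<open>For \<open>k = 0\<close> the previous ratio \<open>t\<^sub>k\<^sub>-\<^sub>1 / \<lambda>\<^sub>k\<^sub>-\<^sub>1\<close> is \<open>\<gamma>\<^sub>b / \<lambda>\<^sub>0\<close>. The first branch is the reading of
  the Polyak ratio as infinite when the block gradient vanishes.\<close>

definition decmsps ::
    "real \<Rightarrow> nat \<Rightarrow> (nat \<Rightarrow> 'a::real_inner \<Rightarrow> real) \<Rightarrow> (nat set \<Rightarrow> real) \<Rightarrow> (nat \<Rightarrow> real) \<Rightarrow> real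
      \<Rightarrow> (nat \<Rightarrow> nat set) \<Rightarrow> (nat \<Rightarrow> 'a) \<Rightarrow> (nat \<Rightarrow> real) \<Rightarrow> bool" where
  "decmsps \<mu> \<tau> f l lam \<gamma>b S x t \<longleftrightarrow>
    (\<forall>k. let prev = (if k = 0 then \<gamma>b / lam 0 else t (k - 1) / lam (k - 1));
             d = (norm (block_grad \<tau> f (S k) (x k)))\<^sup>2
         in t k = lam k * (if d = 0 then prev
              else min (\<mu> * ((block_fun \<tau> f (S k) (x k) - l (S k)) / d)) prev))"

section \<open>The Bregman distances over all realizations\<close>

definition realizations :: "nat set pmf \<Rightarrow> (nat \<Rightarrow> nat set) set" where
  "realizations p = {S. \<forall>j. S j \<in> set_pmf p}"

definition bregman_values ::
    "('a::real_inner \<Rightarrow> real) \<Rightarrow> nat set pmf \<Rightarrow> nat \<Rightarrow> ((nat \<Rightarrow> nat set) \<Rightarrow> nat \<Rightarrow> 'a)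
      \<Rightarrow> ((nat \<Rightarrow> nat set) \<Rightarrow> nat \<Rightarrow> 'a) \<Rightarrow> 'a \<Rightarrow> real set" where
  "bregman_values \<psi> p K x xs xhat =
    {bregman \<psi> (xs S k) (x S k) xhat | S k. S \<in> realizations p \<and> k < K}"

text \<open>The method is causal, so this set of values is finite and its maximum is meaningful.\<close>

lemma sbbp_causal:
  assumes "sbbp \<psi> \<tau> f x0 xs0 S t x xs" "decmsps \<mu> \<tau> f l lam \<gamma>b S x t"
    and "sbbp \<psi> \<tau> f x0 xs0 S' t' x' xs'" "decmsps \<mu> \<tau> f l lam \<gamma>b S' x' t'"
    and "\<And>j. j < k \<Longrightarrow> S j = S' j"
  shows "x k = x' k \<and> xs k = xs' k \<and> (\<forall>j<k. t j = t' j)"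
  using assms(5)
proof (induction k)
  case 0
  then show ?case using assms(1,3) by (simp add: sbbp_def)
next
  case (Suc k)
  then have IH: "x k = x' k" "xs k = xs' k" "\<And>j. j < k \<Longrightarrow> t j = t' j" and S: "S k = S' k"
    by auto
  have prev: "(if k = 0 then \<gamma>b / lam 0 else t (k - 1) / lam (k - 1))
      = (if k = 0 then \<gamma>b / lam 0 else t' (k - 1) / lam (k - 1))"
    using IH(3) by simp
  have t: "t k = t' k"
    using assms(2,4)[unfolded decmsps_def Let_def, THEN spec, of k] unfolding IH(1) S prev
    by (simp only:)
  have xs: "xs (Suc k) = xs' (Suc k)"
    using assms(1,3) IH S t by (simp add: sbbp_def)
  then have "x (Suc k) = x' (Suc k)"
    using assms(1,3) by (simp add: sbbp_def)
  then show ?case using xs t IH(3) by (auto simp: less_Suc_eq)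
qed

lemma finite_bregman_values:
  assumes "set_pmf p \<subseteq> blocks m \<tau>"
    and "\<And>S. (\<forall>j. S j \<in> blocks m \<tau>) \<Longrightarrow> sbbp \<psi> \<tau> f x0 xs0 S (t S) (x S) (xs S)"
    and "\<And>S. (\<forall>j. S j \<in> blocks m \<tau>) \<Longrightarrow> decmsps \<mu> \<tau> f l lam \<gamma>b S (x S) (t S)"
  shows "finite (bregman_values \<psi> p K x xs xhat)"
proof -
  have fin: "finite (set_pmf p)"
    by (rule finite_subset[OF assms(1)])
      (auto simp: blocks_def intro: finite_subset[of _ "Pow {1..m}"])
  obtain B where B: "B \<in> set_pmf p" using set_pmf_not_empty[of p] by blast
  define ext where "ext R = (\<lambda>j. if j < K then R j else B)" for R :: "nat \<Rightarrow> nat set"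
  define A where "A = ext ` (PiE {..<K} (\<lambda>_. set_pmf p))"
  have "finite A" unfolding A_def using fin by (intro finite_imageI finite_PiE) auto
  moreover have "bregman_values \<psi> p K x xs xhat
      \<subseteq> (\<lambda>(S, k). bregman \<psi> (xs S k) (x S k) xhat) ` (A \<times> {..<K})"
  proof
    fix v assume "v \<in> bregman_values \<psi> p K x xs xhat"
    then obtain S k where v: "v = bregman \<psi> (xs S k) (x S k) xhat"
      and S: "\<And>j. S j \<in> set_pmf p" and k: "k < K"
      by (auto simp: bregman_values_def realizations_def)
    define S' where "S' = ext (restrict S {..<K})"
    have "S' \<in> A" unfolding S'_def A_def using S by auto
    have 1: "\<forall>j. S j \<in> blocks m \<tau>" using S assms(1) by blast
    have 2: "\<forall>j. S' j \<in> blocks m \<tau>" using S B assms(1) by (auto simp: S'_def ext_def)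
    have "x S k = x S' k \<and> xs S k = xs S' k \<and> (\<forall>j<k. t S j = t S' j)"
      by (rule sbbp_causal[OF assms(2)[OF 1] assms(3)[OF 1] assms(2)[OF 2] assms(3)[OF 2]])
        (use k in \<open>auto simp: S'_def ext_def\<close>)
    then show "v \<in> (\<lambda>(S, k). bregman \<psi> (xs S k) (x S k) xhat) ` (A \<times> {..<K})"
      using v k \<open>S' \<in> A\<close> by force
  qed
  ultimately show ?thesis by (meson finite_SigmaI finite_imageI finite_lessThan finite_subset)
qed

lemma bregman_values_nonempty:
  assumes "K \<ge> 1"
  shows "bregman_values \<psi> p K x xs xhat \<noteq> {}"
proof -
  obtain B where "B \<in> set_pmf p" using set_pmf_not_empty[of p] by blast
  then have "(\<lambda>_. B) \<in> realizations p" by (simp add: realizations_def)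
  then show ?thesis using assms unfolding bregman_values_def by fastforce
qed

end

theory Submission
  imports Defs
begin

text \<open>
  Strong convexity turns one mirror step into \<open>D\<^sub>k\<^sub>+\<^sub>1 \<le> D\<^sub>k - t\<^sub>k \<langle>g\<^sub>k, x\<^sub>k - z\<rangle> + t\<^sub>k\<^sup>2 \<parallel>g\<^sub>k\<parallel>\<^sup>2 / (2\<mu>)\<close>, and the
  Polyak step makes the last term at most \<open>t\<^sub>k \<lambda>\<^sub>k / 2\<close> times the gap \<open>\<phi>\<^sub>k(x\<^sub>k) - l\<^sub>k\<close>. Since
  \<open>\<parallel>g\<^sub>k\<parallel>\<^sup>2 \<le> 2 L\<^sub>m\<^sub>a\<^sub>x (\<phi>\<^sub>k(x\<^sub>k) - l\<^sub>k)\<close>, the ratios \<open>t\<^sub>k / \<lambda>\<^sub>k\<close> decrease but stay above \<open>L\<close>-tilde. Hence one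
  may divide by \<open>t\<^sub>k\<close> before taking expectations (the step depends on the current block) and sum by
  parts. As \<open>x\<^sub>k\<close> depends on earlier blocks only, block values at \<open>x\<^sub>k\<close> average to the objective,
  whose gap is nonnegative, so the factor \<open>1 - \<lambda>\<^sub>k / 2\<close> may be replaced by \<open>1/2\<close>.
\<close>

section \<open>Strongly convex functions and their conjugates\<close>

text \<open>The defect is the square \<open>(a - \<mu> * b)\<^sup>2 / (2 * \<mu>)\<close>. The bound
  absorbs a term linear in a displacement into the quadratic gain of strong convexity.\<close>

lemma young_le:
  fixes a b \<mu> :: real
  assumes "\<mu> > 0"
  shows "a * b - \<mu> / 2 * b\<^sup>2 \<le> a\<^sup>2 / (2 * \<mu>)"
proof -
  have "a\<^sup>2 / (2 * \<mu>) - (a * b - \<mu> / 2 * b\<^sup>2) = (a - \<mu> * b)\<^sup>2 / (2 * \<mu>)"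
    using assms by (simp add: power2_diff power_mult_distrib field_simps power2_eq_square)
  also have "\<dots> \<ge> 0" using assms by simp
  finally show ?thesis by simp
qed

lemma strongly_convex_imp_convex_on:
  assumes "strongly_convex \<mu> \<psi>" "\<mu> \<ge> 0"
  shows "convex_on UNIV \<psi>"
proof (intro convex_onI)
  fix t :: real and x y assume t: "0 < t" "t < 1"
  have "\<psi> (t *\<^sub>R y + (1 - t) *\<^sub>R x)
      \<le> t * \<psi> y + (1 - t) * \<psi> x - \<mu> / 2 * t * (1 - t) * (norm (y - x))\<^sup>2"
    using assms(1) t unfolding strongly_convex_def by (meson atLeastAtMost_iff less_imp_le)
  moreover have "0 \<le> \<mu> / 2 * t * (1 - t) * (norm (y - x))\<^sup>2"
    using t assms(2) by (intro mult_nonneg_nonneg) auto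
  ultimately show "\<psi> ((1 - t) *\<^sub>R x + t *\<^sub>R y) \<le> (1 - t) * \<psi> x + t * \<psi> y"
    by (simp add: add.commute)
qed simp

text \<open>Strong convexity on the segment from \<open>y\<close> to \<open>z\<close>, combined with
  the subgradient inequality, is divided by the weight \<open>u\<close> of \<open>z\<close>. Then
  \<open>u\<close> tends to 0, which appears in the proof as \<open>s = 1 - u\<close> tending to
  1.\<close>

lemma strongly_convex_subgradient:
  assumes sc: "strongly_convex \<mu> \<psi>" and v: "v \<in> subdifferential \<psi> y"
  shows "\<psi> z \<ge> \<psi> y + v \<bullet> (z - y) + \<mu> / 2 * (norm (z - y))\<^sup>2"
proof -
  have "s * (\<mu> / 2 * (norm (z - y))\<^sup>2) \<le> \<psi> z - \<psi> y - v \<bullet> (z - y)"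
    if s: "0 < s" "s < 1" for s
  proof -
    define u where "u = 1 - s"
    have u: "0 < u" "u < 1" using s by (auto simp: u_def)
    have "\<psi> y + v \<bullet> (u *\<^sub>R z + (1 - u) *\<^sub>R y - y) \<le> \<psi> (u *\<^sub>R z + (1 - u) *\<^sub>R y)"
      using v unfolding subdifferential_def by blast
    also have "\<dots> \<le> u * \<psi> z + (1 - u) * \<psi> y - \<mu> / 2 * u * (1 - u) * (norm (z - y))\<^sup>2"
      using sc u unfolding strongly_convex_def by (meson atLeastAtMost_iff less_imp_le)
    finally have "u * (s * (\<mu> / 2 * (norm (z - y))\<^sup>2)) \<le> u * (\<psi> z - \<psi> y - v \<bullet> (z - y))"
      by (simp add: u_def algebra_simps)
    then show ?thesis using u by simp
  qed
  then have "\<mu> / 2 * (norm (z - y))\<^sup>2 \<le> \<psi> z - \<psi> y - v \<bullet> (z - y)"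
    by (rule field_le_mult_one_interval)
  then show ?thesis by simp
qed

lemma subdifferential_iff_maximizer:
  "v \<in> subdifferential \<psi> y \<longleftrightarrow> (\<forall>z. v \<bullet> z - \<psi> z \<le> v \<bullet> y - \<psi> y)"
  unfolding subdifferential_def by (auto simp: inner_diff_right algebra_simps)

lemma fenchel_conjugate_eq:
  assumes "v \<in> subdifferential \<psi> y"
  shows "fenchel_conjugate \<psi> v = v \<bullet> y - \<psi> y"
  unfolding fenchel_conjugate_def
  using assms by (intro cSup_eq_maximum) (auto simp: subdifferential_iff_maximizer)

text \<open>A vector \<open>v\<close> is a subgradient exactly where
  \<open>v \<bullet> z - \<psi> z\<close> is maximal. The quadratic minorant of
  \<open>\<psi>\<close> at \<open>y0\<close> keeps this function below its value at
  \<open>y0\<close> outside a ball, so a maximum over the compact ball is global.\<close>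

lemma strongly_convex_subdifferential_surj:
  fixes \<psi> :: "'a::euclidean_space \<Rightarrow> real"
  assumes mu: "\<mu> > 0" and sc: "strongly_convex \<mu> \<psi>" and v0: "v0 \<in> subdifferential \<psi> y0"
  shows "\<exists>y. v \<in> subdifferential \<psi> y"
proof -
  \<comment> \<open>Beyond distance \<open>R\<close> from \<open>y0\<close> the quadratic
    \<open>\<mu> / 2 * d\<^sup>2\<close> dominates the linear term
    \<open>norm (v - v0) * d\<close>.\<close>
  define R where "R = 2 * norm (v - v0) / \<mu>"
  have R: "0 \<le> R" using mu by (simp add: R_def)
  have "continuous_on UNIV \<psi>"
    using strongly_convex_imp_convex_on[OF sc] mu by (intro convex_on_continuous) auto
  then have cont: "continuous_on (cball y0 R) (\<lambda>z. v \<bullet> z - \<psi> z)"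
    by (intro continuous_intros) (auto intro: continuous_on_subset)
  have ne: "cball y0 R \<noteq> {}" using R by simp
  obtain y where y: "y \<in> cball y0 R"
    and ymax: "\<And>z. z \<in> cball y0 R \<Longrightarrow> v \<bullet> z - \<psi> z \<le> v \<bullet> y - \<psi> y"
    using continuous_attains_sup[OF compact_cball ne cont] by blast
  have "v \<bullet> z - \<psi> z \<le> v \<bullet> y - \<psi> y" for z
  proof (cases "z \<in> cball y0 R")
    case False
    let ?d = "norm (z - y0)"
    have d: "?d > R" using False by (simp add: dist_norm norm_minus_commute)
    have "(v - v0) \<bullet> (z - y0) \<le> norm (v - v0) * ?d" by (rule norm_cauchy_schwarz)
    also have "\<dots> = \<mu> / 2 * R * ?d" using mu by (simp add: R_def)
    also have "\<dots> \<le> \<mu> / 2 * ?d * ?d"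
      using d mu by (intro mult_right_mono mult_left_mono) auto
    finally have "(v - v0) \<bullet> (z - y0) \<le> \<mu> / 2 * ?d\<^sup>2" by (simp add: power2_eq_square)
    then have "v \<bullet> z - \<psi> z \<le> v \<bullet> y0 - \<psi> y0"
      using strongly_convex_subgradient[OF sc v0, of z]
      by (simp add: inner_diff_left inner_diff_right)
    also have "\<dots> \<le> v \<bullet> y - \<psi> y" using R by (intro ymax) simp
    finally show ?thesis .
  qed (rule ymax)
  then show ?thesis by (auto simp: subdifferential_iff_maximizer)
qed

lemma squared_norm_bound_imp_GDERIV:
  fixes g :: "'a::real_inner \<Rightarrow> real"
  assumes bound: "\<And>w. \<bar>g w - g v - (w - v) \<bullet> D\<bar> \<le> C * (norm (w - v))\<^sup>2"
  shows "GDERIV g v :> D"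
  unfolding gderiv_def
proof (rule has_derivativeI_sandwich[of 1 _ _ _ _ "\<lambda>w. C * norm (w - v)"])
  show "bounded_linear (\<lambda>h. h \<bullet> D)" by (rule bounded_linear_inner_left)
  have "((\<lambda>w. C * norm (w - v)) \<longlongrightarrow> C * norm (v - v)) (at v)"
    by (intro tendsto_intros)
  then show "((\<lambda>w. C * norm (w - v)) \<longlongrightarrow> 0) (at v)" by simp
  fix w assume "w \<in> UNIV" "w \<noteq> v" "dist w v < 1"
  then show "norm (g w - g v - (w - v) \<bullet> D) / norm (w - v) \<le> C * norm (w - v)"
    using bound[of w] by (simp add: divide_simps power2_eq_square mult.assoc)
qed simp

text \<open>If \<open>z\<close> is a maximizer for \<open>w\<close>, the first-order remainder of
  the conjugate is the Bregman distance \<open>bregman \<psi> w z y\<close>. Strong convexity and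
  Young's inequality make it quadratically small in \<open>w - v\<close>.\<close>

lemma GDERIV_fenchel_conjugate:
  fixes \<psi> :: "'a::euclidean_space \<Rightarrow> real"
  assumes mu: "\<mu> > 0" and sc: "strongly_convex \<mu> \<psi>" and y: "v \<in> subdifferential \<psi> y"
  shows "GDERIV (fenchel_conjugate \<psi>) v :> y"
proof (rule squared_norm_bound_imp_GDERIV)
  fix w
  obtain z where z: "w \<in> subdifferential \<psi> z"
    using strongly_convex_subdifferential_surj[OF mu sc y] by blast
  have eq: "fenchel_conjugate \<psi> w - fenchel_conjugate \<psi> v - (w - v) \<bullet> y
      = \<psi> y - \<psi> z - w \<bullet> (y - z)"
    by (simp add: fenchel_conjugate_eq[OF y] fenchel_conjugate_eq[OF z] inner_diff_left
        inner_diff_right)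
  have "0 \<le> \<psi> y - \<psi> z - w \<bullet> (y - z)"
    using z[unfolded subdifferential_iff_maximizer, THEN spec, of y] by (simp add: inner_diff_right)
  moreover have "\<psi> y - \<psi> z - w \<bullet> (y - z) \<le> 1 / (2 * \<mu>) * (norm (w - v))\<^sup>2"
  proof -
    have "\<psi> y - \<psi> z - w \<bullet> (y - z) \<le> (w - v) \<bullet> (z - y) - \<mu> / 2 * (norm (z - y))\<^sup>2"
      using strongly_convex_subgradient[OF sc y, of z]
      by (simp add: inner_diff_left inner_diff_right)
    also have "\<dots> \<le> norm (w - v) * norm (z - y) - \<mu> / 2 * (norm (z - y))\<^sup>2"
      using norm_cauchy_schwarz by simp
    also have "\<dots> \<le> 1 / (2 * \<mu>) * (norm (w - v))\<^sup>2"
      using young_le[OF mu] by simp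
    finally show ?thesis .
  qed
  ultimately show "\<bar>fenchel_conjugate \<psi> w - fenchel_conjugate \<psi> v - (w - v) \<bullet> y\<bar>
      \<le> 1 / (2 * \<mu>) * (norm (w - v))\<^sup>2"
    unfolding eq by simp
qed

text \<open>This keeps the dual iterate a subgradient at the primal iterate. The subgradient
  \<open>v0\<close> at the starting point ensures that every dual vector is a subgradient
  somewhere.\<close>

lemma grad_fenchel_conjugate_subdifferential:
  fixes \<psi> :: "'a::euclidean_space \<Rightarrow> real"
  assumes mu: "\<mu> > 0" and sc: "strongly_convex \<mu> \<psi>" and v0: "v0 \<in> subdifferential \<psi> y0"
  shows "v \<in> subdifferential \<psi> (grad (fenchel_conjugate \<psi>) v)"
proof -
  obtain y where y: "v \<in> subdifferential \<psi> y"
    using strongly_convex_subdifferential_surj[OF mu sc v0] by blast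
  then show ?thesis using grad_eqI[OF GDERIV_fenchel_conjugate[OF mu sc y]] by simp
qed

text \<open>The terms in \<open>z\<close> cancel and leave \<open>g \<bullet> (x - x')\<close> minus
  the strong convexity gain between \<open>x\<close> and \<open>x'\<close>. Young's inequality then
  eliminates \<open>x'\<close>.\<close>

lemma bregman_step:
  assumes mu: "\<mu> > 0" and sc: "strongly_convex \<mu> \<psi>" and v: "v \<in> subdifferential \<psi> x"
  shows "bregman \<psi> (v - g) x' z \<le> bregman \<psi> v x z - g \<bullet> (x - z) + (norm g)\<^sup>2 / (2 * \<mu>)"
proof -
  have "bregman \<psi> (v - g) x' z - bregman \<psi> v x z + g \<bullet> (x - z)
      \<le> g \<bullet> (x - x') - \<mu> / 2 * (norm (x' - x))\<^sup>2"
    using strongly_convex_subgradient[OF sc v, of x']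
    by (simp add: bregman_def inner_diff_left inner_diff_right)
  also have "\<dots> \<le> norm g * norm (x' - x) - \<mu> / 2 * (norm (x' - x))\<^sup>2"
    using norm_cauchy_schwarz[of g "x - x'"] by (simp add: norm_minus_commute)
  also have "\<dots> \<le> (norm g)\<^sup>2 / (2 * \<mu>)" by (rule young_le[OF mu])
  finally show ?thesis by simp
qed

lemma bregman_nonneg:
  assumes "v \<in> subdifferential \<psi> x"
  shows "bregman \<psi> v x y \<ge> 0"
proof -
  have "\<psi> x + v \<bullet> (y - x) \<le> \<psi> y" using assms unfolding subdifferential_def by blast
  then show ?thesis by (simp add: bregman_def)
qed

section \<open>Smooth convex functions\<close>

text \<open>Riesz representation on the standard basis writes the derivative as an inner product, so
  the description in \<open>grad\<close> denotes.\<close>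

lemma differentiable_imp_GDERIV_grad:
  fixes f :: "'a::euclidean_space \<Rightarrow> real"
  assumes "f differentiable at x"
  shows "GDERIV f x :> grad f x"
proof -
  obtain f' where f': "(f has_derivative f') (at x)" using assms by (auto simp: differentiable_def)
  then have lin: "linear f'" by (rule has_derivative_linear)
  have eq: "f' = (\<lambda>h. h \<bullet> (\<Sum>b\<in>Basis. f' b *\<^sub>R b))"
  proof
    fix h
    have "f' h = f' (\<Sum>b\<in>Basis. (h \<bullet> b) *\<^sub>R b)" by (simp only: euclidean_representation)
    also have "\<dots> = (\<Sum>b\<in>Basis. (h \<bullet> b) * f' b)"
      by (simp add: linear_sum[OF lin] linear_scale[OF lin])
    finally show "f' h = h \<bullet> (\<Sum>b\<in>Basis. f' b *\<^sub>R b)"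
      by (simp add: inner_sum_right mult.commute)
  qed
  have "GDERIV f x :> (\<Sum>b\<in>Basis. f' b *\<^sub>R b)"
    unfolding gderiv_def by (rule has_derivative_eq_rhs[OF f' eq])
  then show ?thesis using grad_eqI by metis
qed

lemma GDERIV_along_line:
  assumes "GDERIV f (x + s *\<^sub>R d) :> g"
  shows "((\<lambda>s. f (x + s *\<^sub>R d)) has_real_derivative g \<bullet> d) (at s)"
proof -
  have "((\<lambda>s. x + s *\<^sub>R d) has_derivative (\<lambda>h. h *\<^sub>R d)) (at s)"
    by (auto intro!: derivative_eq_intros)
  moreover have "(f has_derivative (\<lambda>h. h \<bullet> g)) (at (x + s *\<^sub>R d))"
    using assms by (simp add: gderiv_def)
  ultimately have "((\<lambda>s. f (x + s *\<^sub>R d)) has_derivative (\<lambda>h. (h *\<^sub>R d) \<bullet> g)) (at s)"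
    by (rule has_derivative_compose)
  then show ?thesis
    by (simp add: has_field_derivative_def inner_commute mult_commute_abs)
qed

text \<open>Along the line through \<open>x\<close> and \<open>y\<close> this is the tangent
  inequality for a convex function of one real variable.\<close>

lemma convex_on_gradient_inequality:
  fixes f :: "'a::real_inner \<Rightarrow> real"
  assumes cvx: "convex_on UNIV f" and g: "GDERIV f x :> g"
  shows "f y \<ge> f x + g \<bullet> (y - x)"
proof -
  let ?h = "\<lambda>s. f (x + s *\<^sub>R (y - x))"
  have "convex_on UNIV ?h"
  proof (intro convex_onI)
    fix t a b :: real assume t: "0 < t" "t < 1"
    have "x + ((1 - t) *\<^sub>R a + t *\<^sub>R b) *\<^sub>R (y - x)
        = (1 - t) *\<^sub>R (x + a *\<^sub>R (y - x)) + t *\<^sub>R (x + b *\<^sub>R (y - x))"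
      by (simp add: algebra_simps)
    then show "?h ((1 - t) *\<^sub>R a + t *\<^sub>R b) \<le> (1 - t) * ?h a + t * ?h b"
      using convex_onD[OF cvx, of t] t by simp
  qed simp
  moreover have "(?h has_real_derivative g \<bullet> (y - x)) (at 0 within UNIV)"
    using GDERIV_along_line[of f x 0 "y - x" g] g by simp
  ultimately have "?h 1 - ?h 0 \<ge> (g \<bullet> (y - x)) * (1 - 0)"
    by (intro convex_on_imp_above_tangent[of UNIV ?h 0 1]) auto
  then show ?thesis by simp
qed

text \<open>Along the segment, \<open>f\<close> minus its quadratic model has a nonpositive
  derivative by the Lipschitz bound, so it does not increase from \<open>x\<close> to
  \<open>y\<close>.\<close>

lemma lipschitz_gradient_descent:
  assumes g: "\<And>y. GDERIV f y :> g y" and lip: "L-lipschitz_on UNIV g"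
  shows "f y \<le> f x + g x \<bullet> (y - x) + L / 2 * (norm (y - x))\<^sup>2"
proof -
  let ?d = "y - x"
  let ?h = "\<lambda>s. f (x + s *\<^sub>R ?d) - s * (g x \<bullet> ?d) - L / 2 * s\<^sup>2 * (norm ?d)\<^sup>2"
  have "?h 1 \<le> ?h 0"
  proof (rule DERIV_nonpos_imp_nonincreasing[of 0 1 ?h])
    fix s :: real assume s: "0 \<le> s" "s \<le> 1"
    let ?D = "g (x + s *\<^sub>R ?d) \<bullet> ?d - g x \<bullet> ?d - L * s * (norm ?d)\<^sup>2"
    have "(?h has_real_derivative ?D) (at s)"
      using GDERIV_along_line[OF g] by (auto intro!: derivative_eq_intros)
    moreover have "?D \<le> 0"
    proof -
      have "(g (x + s *\<^sub>R ?d) - g x) \<bullet> ?d \<le> norm (g (x + s *\<^sub>R ?d) - g x) * norm ?d"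
        by (rule norm_cauchy_schwarz)
      also have "\<dots> \<le> (L * norm (s *\<^sub>R ?d)) * norm ?d"
        using lipschitz_onD[OF lip, of "x + s *\<^sub>R ?d" x]
        by (intro mult_right_mono) (auto simp: dist_norm)
      finally show ?thesis
        using s by (simp add: inner_diff_left power2_eq_square mult.assoc)
    qed
    ultimately show "\<exists>D. (?h has_real_derivative D) (at s) \<and> D \<le> 0" by blast
  qed simp
  then show ?thesis by simp
qed

text \<open>A gradient step of length \<open>1 / L\<close> lowers \<open>f\<close> by at least
  \<open>(norm (g x))\<^sup>2 / (2 * L)\<close> and cannot go below \<open>l\<close>.\<close>

lemma lipschitz_gradient_squared_norm_le:
  assumes g: "\<And>y. GDERIV f y :> g y" and lip: "L-lipschitz_on UNIV g"
    and L: "L > 0" and lower: "\<And>y. l \<le> f y"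
  shows "(norm (g x))\<^sup>2 \<le> 2 * L * (f x - l)"
proof -
  have "l \<le> f (x - (1 / L) *\<^sub>R g x)" by (rule lower)
  also have "\<dots> \<le> f x + g x \<bullet> (- (1 / L) *\<^sub>R g x) + L / 2 * (norm ((1 / L) *\<^sub>R g x))\<^sup>2"
    using lipschitz_gradient_descent[OF g lip, of "x - (1 / L) *\<^sub>R g x" x] by simp
  also have "\<dots> = f x - (norm (g x))\<^sup>2 / (2 * L)"
    using L by (simp add: power_divide field_simps power2_eq_square flip: power2_norm_eq_inner)
  finally show ?thesis using L by (simp add: field_simps)
qed

lemma lipschitz_on_sum_scaleR:
  fixes g :: "'i \<Rightarrow> 'a::metric_space \<Rightarrow> 'b::real_normed_vector"
  assumes "finite B" "\<And>i. i \<in> B \<Longrightarrow> L-lipschitz_on X (g i)" "\<And>i. i \<in> B \<Longrightarrow> 0 \<le> a i" "L \<ge> 0"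
  shows "(sum a B * L)-lipschitz_on X (\<lambda>x. \<Sum>i\<in>B. a i *\<^sub>R g i x)"
proof (rule lipschitz_onI)
  fix x y assume xy: "x \<in> X" "y \<in> X"
  have "dist (\<Sum>i\<in>B. a i *\<^sub>R g i x) (\<Sum>i\<in>B. a i *\<^sub>R g i y)
      = norm (\<Sum>i\<in>B. a i *\<^sub>R (g i x - g i y))"
    by (simp add: dist_norm sum_subtractf scaleR_diff_right)
  also have "\<dots> \<le> (\<Sum>i\<in>B. a i * (L * dist x y))"
  proof (rule sum_norm_le)
    fix i assume i: "i \<in> B"
    have "norm (g i x - g i y) \<le> L * dist x y"
      using lipschitz_onD[OF assms(2)[OF i] xy] by (simp add: dist_norm)
    then show "norm (a i *\<^sub>R (g i x - g i y)) \<le> a i * (L * dist x y)"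
      using assms(3)[OF i] by (simp add: mult_left_mono)
  qed
  finally show "dist (\<Sum>i\<in>B. a i *\<^sub>R g i x) (\<Sum>i\<in>B. a i *\<^sub>R g i y) \<le> sum a B * L * dist x y"
    by (simp add: sum_distrib_right mult.assoc)
next
  show "0 \<le> sum a B * L" using assms(3,4) by (simp add: sum_nonneg)
qed

section \<open>Regret of mirror descent with decreasing Polyak steps\<close>

text \<open>Summation by parts. The induction carries the leftover \<open>- d (Suc n)\<close>; as
  \<open>D - d (Suc n)\<close> is nonnegative, the decrease of \<open>t\<close> allows the
  denominator to advance by one index.\<close>

lemma sum_diff_divide_le:
  fixes d t :: "nat \<Rightarrow> real"
  assumes t: "\<And>k. t k > 0" "decseq t" and d: "\<And>k. k < K \<Longrightarrow> d k \<le> D" and K: "K \<ge> 1"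
    and last: "d K \<ge> 0"
  shows "(\<Sum>k<K. (d k - d (Suc k)) / t k) \<le> D / t (K - 1)"
proof -
  have "(\<Sum>k<Suc n. (d k - d (Suc k)) / t k) \<le> (D - d (Suc n)) / t n" if "n < K" for n
    using that
  proof (induction n)
    case 0
    then show ?case using d[of 0] t(1)[of 0] by (simp add: divide_right_mono)
  next
    case (Suc n)
    have "(D - d (Suc n)) / t n \<le> (D - d (Suc n)) / t (Suc n)"
      using d[OF Suc.prems] t(1) decseqD[OF t(2), of n "Suc n"] by (intro divide_left_mono) auto
    then have "(\<Sum>k<Suc n. (d k - d (Suc k)) / t k) \<le> (D - d (Suc n)) / t (Suc n)"
      using Suc by simp
    then have "(\<Sum>k<Suc (Suc n). (d k - d (Suc k)) / t k)
        \<le> (D - d (Suc n)) / t (Suc n) + (d (Suc n) - d (Suc (Suc n))) / t (Suc n)"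
      by simp
    also have "\<dots> = (D - d (Suc (Suc n))) / t (Suc n)" by (simp flip: add_divide_distrib)
    finally show ?case .
  qed
  from this[of "K - 1"] have "(\<Sum>k<K. (d k - d (Suc k)) / t k) \<le> (D - d K) / t (K - 1)"
    using K by simp
  also have "\<dots> \<le> D / t (K - 1)" using last t(1) by (intro divide_right_mono) (auto simp: less_imp_le)
  finally show ?thesis .
qed

text \<open>Here \<open>r\<close> stands for \<open>t / lam\<close>. It is the running minimum of
  \<open>r0\<close> and the Polyak quotients with nonzero \<open>d\<close>, each of which is at
  least \<open>\<mu> / (2 * L)\<close>.\<close>

lemma polyak_ratio:
  fixes d gap lam r :: "nat \<Rightarrow> real"
  assumes r: "\<And>k. r k = (let prev = if k = 0 then r0 else r (k - 1)
        in if d k = 0 then prev else min (\<mu> * (gap k / d k)) prev)"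
    and d: "\<And>k. 0 \<le> d k" "\<And>k. d k \<le> 2 * L * gap k" and pos: "L > 0" "\<mu> > 0"
  shows "min (\<mu> / (2 * L)) r0 \<le> r k" and "decseq r" and "r k * d k \<le> \<mu> * gap k"
proof -
  have ratio: "\<mu> / (2 * L) \<le> \<mu> * (gap k / d k)" if "d k \<noteq> 0" for k
  proof -
    have "\<mu> * d k \<le> \<mu> * (2 * L * gap k)" using pos d(2) by (intro mult_left_mono) auto
    moreover have "d k > 0" using that d(1)[of k] by simp
    ultimately show ?thesis using pos by (simp add: field_simps)
  qed
  show "min (\<mu> / (2 * L)) r0 \<le> r k"
  proof (induction k)
    case 0
    show ?case using ratio[of 0] unfolding r[of 0] by (auto simp: Let_def min_le_iff_disj)
  next
    case (Suc k)
    then show ?case using ratio[of "Suc k"] r[of "Suc k"] by (auto simp: Let_def min_le_iff_disj)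
  qed
  show "decseq r"
    by (rule decseq_SucI) (subst r, simp add: Let_def)
  have gap: "gap k \<ge> 0" using order_trans[OF d] pos(1) by (simp add: zero_le_mult_iff)
  show "r k * d k \<le> \<mu> * gap k"
  proof (cases "d k = 0")
    case False
    then have "r k \<le> \<mu> * (gap k / d k)" by (subst r) (simp add: Let_def)
    then have "r k * d k \<le> \<mu> * (gap k / d k) * d k" using d(1) by (intro mult_right_mono)
    then show ?thesis using False by simp
  qed (use gap pos in simp)
qed

text \<open>The functions \<open>\<phi> k\<close> form an arbitrary sequence, so the bound applies
  to each realization of the blocks. Division by \<open>t k\<close> before summing leaves a left
  side free of the random step, ready for expectations.\<close>

lemma mirror_polyak_regret:
  fixes x v :: "nat \<Rightarrow> 'a::real_inner" and \<phi> :: "nat \<Rightarrow> 'a \<Rightarrow> real" and g :: "nat \<Rightarrow> 'a \<Rightarrow> 'a"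
    and l lam t :: "nat \<Rightarrow> real"
  assumes mu: "\<mu> > 0" and sc: "strongly_convex \<mu> \<psi>"
    and v: "\<And>k. v k \<in> subdifferential \<psi> (x k)"
    and step: "\<And>k. v (Suc k) = v k - t k *\<^sub>R g k (x k)"
    and cvx: "\<And>k. convex_on UNIV (\<phi> k)" and grad: "\<And>k y. GDERIV (\<phi> k) y :> g k y"
    and lip: "\<And>k. L-lipschitz_on UNIV (g k)" and L: "L > 0"
    and lower: "\<And>k y. l k \<le> \<phi> k y"
    and lam: "decseq lam" "\<And>k. 0 < lam k" and r0: "r0 > 0"
    and t: "\<And>k. t k = lam k * (let prev = if k = 0 then r0 else t (k - 1) / lam (k - 1);
               d = (norm (g k (x k)))\<^sup>2
             in if d = 0 then prev else min (\<mu> * ((\<phi> k (x k) - l k) / d)) prev)"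
    and K: "K \<ge> 1" and D: "\<And>k. k < K \<Longrightarrow> bregman \<psi> (v k) (x k) z \<le> D"
  shows "(\<Sum>k<K. (1 - lam k / 2) * (\<phi> k (x k) - \<phi> k z) - lam k / 2 * (\<phi> k z - l k))
    \<le> D / (lam (K - 1) * min (\<mu> / (2 * L)) r0)"
proof -
  define r where "r k = t k / lam k" for k
  let ?d = "\<lambda>k. (norm (g k (x k)))\<^sup>2" and ?b = "\<lambda>k. bregman \<psi> (v k) (x k) z"
  let ?gap = "\<lambda>k. \<phi> k (x k) - l k" and ?Lt = "min (\<mu> / (2 * L)) r0"
  have tr: "t k = lam k * r k" for k using lam(2)[of k] by (simp add: r_def)
  have "r k = (let prev = if k = 0 then r0 else r (k - 1)
      in if ?d k = 0 then prev else min (\<mu> * (?gap k / ?d k)) prev)" for k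
    using t[of k] lam(2)[of k] unfolding tr[of k] r_def[symmetric] by (simp add: Let_def)
  moreover have "?d k \<le> 2 * L * ?gap k" for k
    by (rule lipschitz_gradient_squared_norm_le[OF grad lip L lower])
  ultimately have r: "\<And>k. ?Lt \<le> r k" "decseq r" and polyak: "\<And>k. r k * ?d k \<le> \<mu> * ?gap k"
    using polyak_ratio[of r r0 ?d \<mu> ?gap L] L mu by auto
  have Lt: "?Lt > 0" using mu L r0 by simp
  then have r_pos: "r k > 0" for k using r(1) less_le_trans by blast
  have t_pos: "t k > 0" for k using r_pos lam(2) by (simp add: tr)
  have t_dec: "decseq t"
  proof (rule decseq_SucI)
    fix k
    show "t (Suc k) \<le> t k"
      unfolding tr using decseqD[OF lam(1), of k "Suc k"] decseqD[OF r(2), of k "Suc k"]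
        lam(2)[of k] r_pos[of "Suc k"] by (intro mult_mono) auto
  qed
  have "(1 - lam k / 2) * (\<phi> k (x k) - \<phi> k z) - lam k / 2 * (\<phi> k z - l k)
      \<le> (?b k - ?b (Suc k)) / t k" for k
  proof -
    have descent: "?b (Suc k) \<le> ?b k - t k * (g k (x k) \<bullet> (x k - z)) + (t k)\<^sup>2 * ?d k / (2 * \<mu>)"
      using bregman_step[OF mu sc v, of k "t k *\<^sub>R g k (x k)" "x (Suc k)" z]
      by (simp add: step power_mult_distrib)
    \<comment> \<open>One of the two factors \<open>t k\<close> is written as
      \<open>lam k * r k\<close>, so that \<open>polyak\<close> trades the squared gradient for the
      gap.\<close>
    have size: "(t k)\<^sup>2 * ?d k / (2 * \<mu>) \<le> t k * (lam k / 2 * ?gap k)"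
    proof -
      have "(t k)\<^sup>2 * ?d k = t k * lam k * (r k * ?d k)" by (simp add: tr power2_eq_square)
      also have "\<dots> \<le> t k * lam k * (\<mu> * ?gap k)"
        using polyak t_pos lam(2) by (intro mult_left_mono) (auto simp: less_imp_le)
      finally show ?thesis using mu by (simp add: field_simps)
    qed
    have gradient: "t k * (g k (x k) \<bullet> (x k - z)) \<ge> t k * (\<phi> k (x k) - \<phi> k z)"
      using convex_on_gradient_inequality[OF cvx grad, of k "x k" z] t_pos[of k]
      by (simp add: inner_diff_right)
    \<comment> \<open>The gap splits at \<open>\<phi> k z\<close>: the part above it lowers the
      coefficient to \<open>1 - lam k / 2\<close>, the part below it is the noise.\<close>
    have "t k * ((1 - lam k / 2) * (\<phi> k (x k) - \<phi> k z) - lam k / 2 * (\<phi> k z - l k))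
        = t k * (\<phi> k (x k) - \<phi> k z) - t k * (lam k / 2 * ?gap k)"
      by (simp add: field_simps)
    then have "t k * ((1 - lam k / 2) * (\<phi> k (x k) - \<phi> k z) - lam k / 2 * (\<phi> k z - l k))
        \<le> ?b k - ?b (Suc k)"
      using descent size gradient by linarith
    then show ?thesis using t_pos[of k] by (simp add: pos_le_divide_eq mult.commute)
  qed
  then have "(\<Sum>k<K. (1 - lam k / 2) * (\<phi> k (x k) - \<phi> k z) - lam k / 2 * (\<phi> k z - l k))
      \<le> (\<Sum>k<K. (?b k - ?b (Suc k)) / t k)"
    by (rule sum_mono)
  also have "\<dots> \<le> D / t (K - 1)"
    by (rule sum_diff_divide_le[OF t_pos t_dec D K bregman_nonneg[OF v]])
  \<comment> \<open>Replacing the last step by its lower bound enlarges the quotient because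
    \<open>D\<close> dominates a nonnegative Bregman distance.\<close>
  also have "\<dots> \<le> D / (lam (K - 1) * ?Lt)"
  proof (rule divide_left_mono)
    show "lam (K - 1) * ?Lt \<le> t (K - 1)" unfolding tr using r(1) lam(2) by (simp add: less_imp_le)
    show "0 \<le> D" using D[of 0] bregman_nonneg[OF v[of 0]] K by (meson less_le_trans order_trans zero_less_one)
    show "0 < t (K - 1) * (lam (K - 1) * ?Lt)"
      using Lt lam(2) t_pos by (intro mult_pos_pos) auto
  qed
  finally show ?thesis .
qed

section \<open>Block functions\<close>

lemma block_fun_convex:
  assumes "\<And>i. i \<in> B \<Longrightarrow> convex_on UNIV (f i)"
  shows "convex_on UNIV (block_fun \<tau> f B)"
proof -
  have "block_fun \<tau> f B ((1 - t) *\<^sub>R x + t *\<^sub>R y) \<le> (1 - t) * block_fun \<tau> f B x + t * block_fun \<tau> f B y"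
    if "0 < t" "t < 1" for t x y
  proof -
    have "block_fun \<tau> f B ((1 - t) *\<^sub>R x + t *\<^sub>R y)
        \<le> (\<Sum>i\<in>B. (1 / real \<tau>) * ((1 - t) * f i x + t * f i y))"
      unfolding block_fun_def using convex_onD[OF assms] that
      by (intro sum_mono mult_left_mono) auto
    also have "\<dots> = (1 - t) * block_fun \<tau> f B x + t * block_fun \<tau> f B y"
      by (simp add: block_fun_def sum_distrib_left sum.distrib algebra_simps add_divide_distrib diff_divide_distrib sum_subtractf)
    finally show ?thesis .
  qed
  then show ?thesis by (intro convex_onI) auto
qed

lemma GDERIV_block_fun:
  assumes "\<And>i. i \<in> B \<Longrightarrow> GDERIV (f i) y :> grad (f i) y"
  shows "GDERIV (block_fun \<tau> f B) y :> block_grad \<tau> f B y"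
proof -
  have "((\<lambda>y. \<Sum>i\<in>B. (1 / real \<tau>) * f i y) has_derivative
      (\<lambda>h. \<Sum>i\<in>B. (1 / real \<tau>) * (h \<bullet> grad (f i) y))) (at y)"
    using assms unfolding gderiv_def by (intro has_derivative_sum has_derivative_mult_right) auto
  then show ?thesis
    by (simp add: gderiv_def block_fun_def[abs_def] block_grad_def inner_sum_right)
qed

text \<open>The weights of a block sum to 1, so the average keeps the common Lipschitz
  constant.\<close>

lemma lipschitz_on_block_grad:
  fixes f :: "nat \<Rightarrow> 'a::real_inner \<Rightarrow> real"
  assumes B: "B \<in> blocks m \<tau>" and tau: "\<tau> > 0"
    and lip: "\<And>i. i \<in> {1..m} \<Longrightarrow> L-lipschitz_on X (grad (f i))" and L: "L \<ge> 0"
  shows "L-lipschitz_on X (block_grad \<tau> f B)"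
proof -
  have "finite B" "card B = \<tau>" "B \<subseteq> {1..m}"
    using B by (auto simp: blocks_def intro: finite_subset)
  then have "((\<Sum>i\<in>B. 1 / real \<tau>) * L)-lipschitz_on X (\<lambda>x. \<Sum>i\<in>B. (1 / real \<tau>) *\<^sub>R grad (f i) x)"
    using L by (intro lipschitz_on_sum_scaleR lip) auto
  then show ?thesis using tau \<open>card B = \<tau>\<close> by (simp add: block_grad_def[abs_def])
qed

text \<open>Seen as the full block with \<open>\<tau> = m\<close>, the objective inherits convexity
  from the block functions.\<close>

lemma objective_eq_block_fun: "objective m f = block_fun m f {1..m}"
  by (simp add: objective_def block_fun_def sum_distrib_left fun_eq_iff)

lemma finite_blocks: "finite (blocks m \<tau>)"
  by (rule finite_subset[of _ "Pow {1..m}"]) (auto simp: blocks_def)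

text \<open>After exchanging the sums, \<open>a i\<close> carries the probability
  \<open>\<tau> / m\<close> that \<open>i\<close> is drawn times the weight
  \<open>1 / \<tau>\<close>.\<close>

lemma expected_block_sum:
  fixes p :: "nat set pmf" and a :: "nat \<Rightarrow> real"
  assumes p: "set_pmf p \<subseteq> blocks m \<tau>" and tau: "\<tau> > 0"
    and marg: "\<And>i. i \<in> {1..m} \<Longrightarrow> measure_pmf.prob p {B. i \<in> B} = real \<tau> / real m"
  shows "(\<Sum>B\<in>blocks m \<tau>. pmf p B * (\<Sum>i\<in>B. (1 / real \<tau>) * a i)) = (1 / real m) * (\<Sum>i=1..m. a i)"
proof -
  let ?A = "blocks m \<tau>"
  have "(\<Sum>B\<in>?A. pmf p B * (\<Sum>i\<in>B. (1 / real \<tau>) * a i))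
      = (\<Sum>B\<in>?A. \<Sum>i=1..m. pmf p B * (if i \<in> B then (1 / real \<tau>) * a i else 0))"
  proof (rule sum.cong[OF refl])
    fix B assume "B \<in> ?A"
    then have "(\<Sum>i\<in>B. (1 / real \<tau>) * a i) = (\<Sum>i=1..m. if i \<in> B then (1 / real \<tau>) * a i else 0)"
      by (intro sum.mono_neutral_cong_left) (auto simp: blocks_def)
    then show "pmf p B * (\<Sum>i\<in>B. (1 / real \<tau>) * a i)
        = (\<Sum>i=1..m. pmf p B * (if i \<in> B then (1 / real \<tau>) * a i else 0))"
      by (simp add: sum_distrib_left)
  qed
  also have "\<dots> = (\<Sum>i=1..m. \<Sum>B\<in>?A. pmf p B * (if i \<in> B then (1 / real \<tau>) * a i else 0))"
    by (rule sum.swap)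
  also have "\<dots> = (\<Sum>i=1..m. (1 / real m) * a i)"
  proof (rule sum.cong[OF refl])
    fix i assume i: "i \<in> {1..m}"
    have "real \<tau> / real m = measure_pmf.prob p ({B. i \<in> B} \<inter> set_pmf p)"
      using marg[OF i] by (simp add: measure_Int_set_pmf)
    also have "\<dots> = (\<Sum>B\<in>{B. i \<in> B} \<inter> set_pmf p. pmf p B)"
      using finite_subset[OF p finite_blocks] by (intro measure_measure_pmf_finite) auto
    also have "\<dots> = (\<Sum>B\<in>?A. if i \<in> B then pmf p B else 0)"
      using p by (intro sum.mono_neutral_cong_left finite_blocks) (auto simp: set_pmf_iff)
    finally have "(\<Sum>B\<in>?A. if i \<in> B then pmf p B else 0) = real \<tau> / real m" ..
    then have "(\<Sum>B\<in>?A. if i \<in> B then pmf p B else 0) * ((1 / real \<tau>) * a i) = (1 / real m) * a i"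
      using tau by simp
    then show "(\<Sum>B\<in>?A. pmf p B * (if i \<in> B then (1 / real \<tau>) * a i else 0)) = (1 / real m) * a i"
      by (subst (asm) sum_distrib_right) (simp add: if_distrib if_distribR cong: if_cong)
  qed
  finally show ?thesis by (simp add: sum_distrib_left)
qed

section \<open>Independent finitely valued random variables\<close>

context prob_space
begin

lemma integrable_finite_valued:
  fixes h :: "'b \<Rightarrow> real"
  assumes X: "X \<in> M \<rightarrow>\<^sub>M count_space A" and A: "finite A"
  shows "integrable M (\<lambda>\<omega>. h (X \<omega>))"
proof (rule integrable_const_bound)
  have "\<bar>h (X \<omega>)\<bar> \<le> (\<Sum>a\<in>A. \<bar>h a\<bar>)" if "\<omega> \<in> space M" for \<omega>
    using measurable_space[OF X that] A by (intro member_le_sum) auto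
  then show "AE \<omega> in M. norm (h (X \<omega>)) \<le> (\<Sum>a\<in>A. \<bar>h a\<bar>)" by simp
  show "(\<lambda>\<omega>. h (X \<omega>)) \<in> borel_measurable M" using measurable_compose[OF X, of h borel] by simp
qed

text \<open>Over a finite alphabet the finite product of count spaces is again a count space, so
  every function of the history is measurable.\<close>

lemma measurable_history:
  assumes "indep_vars (\<lambda>_. count_space A) J UNIV" "finite A"
  shows "(\<lambda>\<omega>. restrict (\<lambda>j. J j \<omega>) {..<k::nat}) \<in> M \<rightarrow>\<^sub>M count_space (PiE {..<k} (\<lambda>_. A))"
proof -
  have "J j \<in> M \<rightarrow>\<^sub>M count_space A" for j using assms(1) by (auto simp: indep_vars_def)
  then have "(\<lambda>\<omega>. restrict (\<lambda>j. J j \<omega>) {..<k}) \<in> M \<rightarrow>\<^sub>M PiM {..<k} (\<lambda>_. count_space A)"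
    by (intro measurable_restrict)
  then show ?thesis
    using assms(2) by (simp add: count_space_PiM_finite countable_finite)
qed

text \<open>The current block is averaged out with the past held fixed. Expanding \<open>G\<close>
  over the values \<open>b\<close> of \<open>J k\<close> makes each term a product of two
  independent variables, which replaces conditional expectation.\<close>

lemma expectation_history:
  fixes G :: "(nat \<Rightarrow> 'b) \<Rightarrow> 'b \<Rightarrow> real" and k :: nat
  assumes ind: "indep_vars (\<lambda>_. count_space A) J UNIV" and A: "finite A"
  defines "H \<equiv> \<lambda>\<omega>. restrict (\<lambda>j. J j \<omega>) {..<k}"
  shows "expectation (\<lambda>\<omega>. G (H \<omega>) (J k \<omega>))
    = expectation (\<lambda>\<omega>. \<Sum>b\<in>A. prob {\<omega> \<in> space M. J k \<omega> = b} * G (H \<omega>) b)"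
proof -
  have Y: "J k \<in> M \<rightarrow>\<^sub>M count_space A" using ind by (auto simp: indep_vars_def)
  have intX: "integrable M (\<lambda>\<omega>. G (H \<omega>) b)" for b
    unfolding H_def using A
    by (intro integrable_finite_valued[OF measurable_history[OF ind A]] finite_PiE) auto
  have intY: "integrable M (\<lambda>\<omega>. indicator {b} (J k \<omega>) :: real)" for b
    by (rule integrable_finite_valued[OF Y A])
  have indb: "indep_var borel (\<lambda>\<omega>. G (H \<omega>) b) borel (\<lambda>\<omega>. indicator {b} (J k \<omega>) :: real)" for b
  proof -
    have PiM: "PiM I (\<lambda>_. count_space A) = count_space (PiE I (\<lambda>_. A))" if "finite I" for I :: "nat set"
      using that A by (intro count_space_PiM_finite) (auto intro: countable_finite)
    have "indep_var (PiM {..<k} (\<lambda>_. count_space A)) H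
        (PiM {k} (\<lambda>_. count_space A)) (\<lambda>\<omega>. restrict (\<lambda>j. J j \<omega>) {k})"
      unfolding H_def by (rule indep_var_restrict[OF ind]) auto
    then have "indep_var borel ((\<lambda>s. G s b) \<circ> H)
        borel ((\<lambda>s. indicator {b} (s k) :: real) \<circ> (\<lambda>\<omega>. restrict (\<lambda>j. J j \<omega>) {k}))"
      by (rule indep_var_compose) (simp_all add: PiM)
    then show ?thesis by (simp add: o_def)
  qed
  have "expectation (\<lambda>\<omega>. G (H \<omega>) (J k \<omega>))
      = expectation (\<lambda>\<omega>. \<Sum>b\<in>A. G (H \<omega>) b * indicator {b} (J k \<omega>))"
  proof (rule Bochner_Integration.integral_cong[OF refl])
    fix \<omega> assume "\<omega> \<in> space M"
    then have "J k \<omega> \<in> A" using measurable_space[OF Y] by simp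
    then show "G (H \<omega>) (J k \<omega>) = (\<Sum>b\<in>A. G (H \<omega>) b * indicator {b} (J k \<omega>))"
      using A by (simp add: indicator_def if_distrib cong: if_cong)
  qed
  also have "\<dots> = (\<Sum>b\<in>A. expectation (\<lambda>\<omega>. G (H \<omega>) b * indicator {b} (J k \<omega>)))"
    using indep_var_integrable[OF indb intX intY] by (intro Bochner_Integration.integral_sum)
  also have "\<dots> = (\<Sum>b\<in>A. expectation (\<lambda>\<omega>. G (H \<omega>) b) * prob {\<omega> \<in> space M. J k \<omega> = b})"
  proof (rule sum.cong[OF refl])
    fix b
    have "expectation (\<lambda>\<omega>. indicator {b} (J k \<omega>) :: real)
        = expectation (indicator {\<omega> \<in> space M. J k \<omega> = b})"
      by (rule Bochner_Integration.integral_cong) (auto simp: indicator_def)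
    also have "\<dots> = prob {\<omega> \<in> space M. J k \<omega> = b}" by (simp add: Int_def conj_ac)
    finally show "expectation (\<lambda>\<omega>. G (H \<omega>) b * indicator {b} (J k \<omega>))
        = expectation (\<lambda>\<omega>. G (H \<omega>) b) * prob {\<omega> \<in> space M. J k \<omega> = b}"
      using indep_var_lebesgue_integral[OF indb intX intY] by simp
  qed
  also have "\<dots> = expectation (\<lambda>\<omega>. \<Sum>b\<in>A. prob {\<omega> \<in> space M. J k \<omega> = b} * G (H \<omega>) b)"
    using intX by (simp add: mult.commute)
  finally show ?thesis .
qed

end

section \<open>The convergence rates\<close>

text \<open>Each term is at most the increment of \<open>2 * sqrt n\<close>, so the sum
  telescopes.\<close>

lemma sum_inverse_sqrt_le: "(\<Sum>k<n. 1 / sqrt (real (k + 1))) \<le> 2 * sqrt (real n)"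
proof (induction n)
  case (Suc n)
  have "1 / sqrt (real (n + 1)) \<le> 2 * sqrt (real (n + 1)) - 2 * sqrt (real n)"
  proof -
    have "2 * sqrt (real n) * sqrt (real (n + 1)) \<le> (sqrt (real n))\<^sup>2 + (sqrt (real (n + 1)))\<^sup>2"
      by (rule sum_squares_bound)
    then have "1 \<le> (2 * sqrt (real (n + 1)) - 2 * sqrt (real n)) * sqrt (real (n + 1))"
      by (simp add: algebra_simps)
    then show ?thesis by (simp add: pos_divide_le_eq)
  qed
  then show ?case using Suc by simp
qed simp

theorem corollary1:
  fixes \<psi> :: "real ^ 'n \<Rightarrow> real"
    and f :: "nat \<Rightarrow> real ^ 'n \<Rightarrow> real"
    and L :: "nat \<Rightarrow> real"
    and m \<tau> K :: nat
    and \<mu> \<gamma>b D Lmax Ltilde Fbar \<sigma>2 :: real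
    and lam :: "nat \<Rightarrow> real"
    and l :: "nat set \<Rightarrow> real"
    and p :: "nat set pmf"
    and M :: "'w measure"
    and J :: "nat \<Rightarrow> 'w \<Rightarrow> nat set"
    and x0 xs0 xhat :: "real ^ 'n"
    and x xs :: "(nat \<Rightarrow> nat set) \<Rightarrow> nat \<Rightarrow> real ^ 'n"
    and t :: "(nat \<Rightarrow> nat set) \<Rightarrow> nat \<Rightarrow> real"
    and xbar :: "'w \<Rightarrow> real ^ 'n"
  assumes psi: "\<mu> > 0" "strongly_convex \<mu> \<psi>"
    and f_convex: "\<And>i. i \<in> {1..m} \<Longrightarrow> convex_on UNIV (f i)"
    and f_diff: "\<And>i. i \<in> {1..m} \<Longrightarrow> f i differentiable_on UNIV"
    and L_pos: "\<And>i. i \<in> {1..m} \<Longrightarrow> L i > 0"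
    and f_smooth: "\<And>i. i \<in> {1..m} \<Longrightarrow> (L i)-lipschitz_on UNIV (grad (f i))"
    and Lmax: "Lmax = Max (L ` {1..m})"
    and Fbar: "Fbar = (INF y. objective m f y)"
    and xhat: "xhat \<in> minimizers (objective m f)"
    and tau: "\<tau> \<in> {1..m}"
    and p_blocks: "set_pmf p \<subseteq> blocks m \<tau>"
    and p_marginal: "\<And>i. i \<in> {1..m} \<Longrightarrow> measure_pmf.prob p {B. i \<in> B} = real \<tau> / real m"
    and M: "prob_space M"
    and J_indep: "prob_space.indep_vars M (\<lambda>_. count_space (blocks m \<tau>)) J UNIV"
    and J_distr: "\<And>k B. measure M {\<omega> \<in> space M. J k \<omega> = B} = pmf p B"
    and l_lower: "\<And>B. B \<in> set_pmf p \<Longrightarrow> ereal (l B) \<le> (INF y. ereal (block_fun \<tau> f B y))"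
    and lam: "decseq lam" "\<And>k. 0 < lam k" "\<And>k. lam k \<le> 1"
    and gamma_b: "\<gamma>b > 0"
    and init: "xs0 \<in> subdifferential \<psi> x0"
    and iterates: "\<And>S. (\<forall>j. S j \<in> blocks m \<tau>) \<Longrightarrow> sbbp \<psi> \<tau> f x0 xs0 S (t S) (x S) (xs S)"
    and stepsize: "\<And>S. (\<forall>j. S j \<in> blocks m \<tau>) \<Longrightarrow> decmsps \<mu> \<tau> f l lam \<gamma>b S (x S) (t S)"
    and sigma: "\<sigma>2 = noise_sq p \<tau> f l xhat"
    and K: "K \<ge> 1"
    and D: "D = Max (bregman_values \<psi> p K x xs xhat)"
    and xbar: "\<And>\<omega>. \<omega> \<in> space M \<Longrightarrow> xbar \<omega> = (1 / real K) *\<^sub>R (\<Sum>k<K. x (\<lambda>j. J j \<omega>) k)"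
    and Ltilde: "Ltilde = min (\<mu> / (2 * Lmax)) (\<gamma>b / lam 0)"
  shows "(\<forall>c. \<sigma>2 = 0 \<and> c \<ge> 1 \<and> (\<forall>k. lam k = 1 / c) \<longrightarrow>
            (\<integral>\<omega>. objective m f (xbar \<omega>) - Fbar \<partial>M) \<le> 2 * D * c / (real K * Ltilde))
       \<and> (\<forall>c. \<sigma>2 > 0 \<and> c > 0 \<and> (\<forall>k. lam k = 1 / (c * sqrt (real (k + 1)))) \<longrightarrow>
            (\<integral>\<omega>. objective m f (xbar \<omega>) - Fbar \<partial>M)
              \<le> (2 * c * D / Ltilde + 2 * \<sigma>2 / c) / sqrt (real K))"
proof -

  \<comment> \<open>Random blocks and their support\<close>
  interpret prob_space M by (rule M)
  let ?A = "blocks m \<tau>" and ?\<phi> = "block_fun \<tau> f" and ?F = "objective m f"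
  define S where "S \<omega> = (\<lambda>j. J j \<omega>)" for \<omega>
  define C where "C = D / (lam (K - 1) * Ltilde)"
  define Z where "Z \<omega> k = ?\<phi> (J k \<omega>) (x (S \<omega>) k) - ?\<phi> (J k \<omega>) xhat" for \<omega> k
  define N where "N \<omega> k = ?\<phi> (J k \<omega>) xhat - l (J k \<omega>)" for \<omega> k
  define H where "H k \<omega> = restrict (S \<omega>) {..<k}" for k :: nat and \<omega>
  have tau_pos: "\<tau> > 0" using tau by simp
  have fin_A: "finite ?A" by (rule finite_blocks)
  have J_rv: "J k \<in> M \<rightarrow>\<^sub>M count_space ?A" for k using J_indep by (auto simp: indep_vars_def)
  have J_blocks: "\<forall>j. S \<omega> j \<in> ?A" if "\<omega> \<in> space M" for \<omega>
    using measurable_space[OF J_rv that] by (simp add: S_def)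
  \<comment> \<open>The bounds \<open>l\<close> and the maximum \<open>D\<close> concern blocks in
    the support of \<open>p\<close> only. The finitely many other blocks have probability zero at
    each of the countably many iterations.\<close>
  have J_supp: "AE \<omega> in M. \<forall>k. J k \<omega> \<in> set_pmf p"
  proof (subst AE_all_countable, rule allI)
    fix k
    have "AE \<omega> in M. \<forall>B\<in>?A - set_pmf p. J k \<omega> \<noteq> B"
    proof (rule AE_finite_allI)
      fix B assume B: "B \<in> ?A - set_pmf p"
      then have "{\<omega> \<in> space M. J k \<omega> = B} \<in> sets M"
        using measurable_sets[OF J_rv, of "{B}"] by (simp add: vimage_def Int_def conj_commute)
      moreover have "prob {\<omega> \<in> space M. J k \<omega> = B} = 0"
        using B J_distr by (simp add: set_pmf_iff)
      ultimately show "AE \<omega> in M. J k \<omega> \<noteq> B" by (simp add: prob_eq_0)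
    qed (use fin_A in simp)
    then show "AE \<omega> in M. J k \<omega> \<in> set_pmf p"
      using AE_space by eventually_elim (use J_blocks in \<open>auto simp: S_def\<close>)
  qed

  \<comment> \<open>Uniform smoothness and the minimum of the objective\<close>
  have Lmax_ge: "L i \<le> Lmax" if "i \<in> {1..m}" for i using that by (simp add: Lmax)
  have Lmax_pos: "Lmax > 0" using L_pos[OF tau] Lmax_ge[OF tau] by linarith
  have Ltilde_pos: "Ltilde > 0" using psi Lmax_pos gamma_b lam(2) by (simp add: Ltilde)
  have smooth: "Lmax-lipschitz_on UNIV (grad (f i))" if "i \<in> {1..m}" for i
    using f_smooth[OF that] Lmax_ge[OF that] by (rule lipschitz_on_le)
  have gderiv: "GDERIV (f i) y :> grad (f i) y" if "i \<in> {1..m}" for i y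
    using f_diff[OF that] by (intro differentiable_imp_GDERIV_grad) (simp add: differentiable_on_def)
  have F_convex: "convex_on UNIV ?F"
    unfolding objective_eq_block_fun using f_convex by (rule block_fun_convex)
  have F_min: "?F xhat \<le> ?F y" for y
    using xhat by (auto simp: minimizers_def is_arg_min_linorder)
  have Fbar_eq: "Fbar = ?F xhat"
    unfolding Fbar by (rule cInf_eq_minimum) (auto intro: F_min)

  \<comment> \<open>Regret along one realization\<close>
  have lower: "l B \<le> ?\<phi> B y" if "B \<in> set_pmf p" for B y
    using order_trans[OF l_lower[OF that] INF_lower[of y UNIV]] by simp
  have regret: "(\<Sum>k<K. (1 - lam k / 2) * Z \<omega> k - lam k / 2 * N \<omega> k) \<le> C"
    if \<omega>: "\<omega> \<in> space M" and supp: "\<forall>k. J k \<omega> \<in> set_pmf p" for \<omega>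
  proof -
    note it = iterates[OF J_blocks[OF \<omega>]] and st = stepsize[OF J_blocks[OF \<omega>]]
    let ?x = "x (S \<omega>)" and ?xs = "xs (S \<omega>)" and ?t = "t (S \<omega>)"
    have B: "S \<omega> k \<subseteq> {1..m}" for k using J_blocks[OF \<omega>] by (auto simp: blocks_def)
    \<comment> \<open>The pairing holds at index 0 by \<open>init\<close>, and later because each
      primal iterate is the conjugate gradient at the dual iterate.\<close>
    have sub: "?xs k \<in> subdifferential \<psi> (?x k)" for k
      using it init grad_fenchel_conjugate_subdifferential[OF psi init]
      by (cases k) (auto simp: sbbp_def)
    have breg: "bregman \<psi> (?xs k) (?x k) xhat \<le> D" if "k < K" for k
    proof -
      have "S \<omega> \<in> realizations p" using supp by (simp add: realizations_def S_def)
      then show ?thesis unfolding D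
        using that finite_bregman_values[OF p_blocks iterates stepsize]
        by (intro Max_ge) (auto simp: bregman_values_def)
    qed
    have "(\<Sum>k<K. (1 - lam k / 2) * (?\<phi> (S \<omega> k) (?x k) - ?\<phi> (S \<omega> k) xhat)
          - lam k / 2 * (?\<phi> (S \<omega> k) xhat - l (S \<omega> k)))
        \<le> D / (lam (K - 1) * min (\<mu> / (2 * Lmax)) (\<gamma>b / lam 0))"
    proof (rule mirror_polyak_regret[OF psi sub _ _ _ _ Lmax_pos _ lam(1,2) _ _ K breg])
      show "?xs (Suc k) = ?xs k - ?t k *\<^sub>R block_grad \<tau> f (S \<omega> k) (?x k)" for k
        using it by (simp add: sbbp_def)
      show "convex_on UNIV (?\<phi> (S \<omega> k))" for k using B[of k] by (intro block_fun_convex f_convex) auto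
      show "GDERIV (?\<phi> (S \<omega> k)) y :> block_grad \<tau> f (S \<omega> k) y" for k y
        using B[of k] by (intro GDERIV_block_fun gderiv) auto
      show "Lmax-lipschitz_on UNIV (block_grad \<tau> f (S \<omega> k))" for k
        using J_blocks[OF \<omega>] tau_pos smooth Lmax_pos by (intro lipschitz_on_block_grad) auto
      show "l (S \<omega> k) \<le> ?\<phi> (S \<omega> k) y" for k y using supp by (intro lower) (simp add: S_def)
      show "0 < \<gamma>b / lam 0" using gamma_b lam(2) by simp
      show "?t k = lam k * (let prev = if k = 0 then \<gamma>b / lam 0 else ?t (k - 1) / lam (k - 1);
              d = (norm (block_grad \<tau> f (S \<omega> k) (?x k)))\<^sup>2
            in if d = 0 then prev
               else min (\<mu> * ((?\<phi> (S \<omega> k) (?x k) - l (S \<omega> k)) / d)) prev)" for k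
        using st[unfolded decmsps_def, THEN spec, of k] by (simp only: Let_def)
    qed
    then show ?thesis by (simp add: Z_def N_def S_def C_def Ltilde)
  qed

  \<comment> \<open>Iterates as functions of the block history\<close>
  obtain B0 where B0: "B0 \<in> set_pmf p" using set_pmf_not_empty[of p] by blast
  \<comment> \<open>Any block may fill the positions from \<open>k\<close> on: by causality they do not affect \<open>x\<^sub>k\<close>.\<close>
  define xh where "xh k s = x (\<lambda>j. if j < k then s j else B0) k" for k :: nat and s
  \<comment> \<open>Histories longer than \<open>k\<close> are allowed: \<open>Z\<close> also
    contains block \<open>k\<close> and needs length \<open>Suc k\<close>, and \<open>xbar\<close>
    needs length \<open>K\<close> for all iterates at once.\<close>
  have x_eq: "x (S \<omega>) k = xh k (H n \<omega>)" if \<omega>: "\<omega> \<in> space M" and "k \<le> n" for \<omega> k n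
  proof -
    have 1: "\<forall>j. (if j < k then H n \<omega> j else B0) \<in> ?A"
      using J_blocks[OF \<omega>] B0 p_blocks that(2) by (auto simp: H_def)
    show ?thesis
      unfolding xh_def
      using sbbp_causal[OF iterates[OF J_blocks[OF \<omega>]] stepsize[OF J_blocks[OF \<omega>]]
          iterates[OF 1] stepsize[OF 1], of k] that(2)
      by (simp add: H_def)
  qed
  have int_H: "integrable M (\<lambda>\<omega>. h (H n \<omega>))" for h :: "_ \<Rightarrow> real" and n
    unfolding H_def S_def using fin_A
    by (intro integrable_finite_valued[OF measurable_history[OF J_indep fin_A]] finite_PiE) auto
  have int_cong: "integrable M g" if "\<And>\<omega>. \<omega> \<in> space M \<Longrightarrow> g \<omega> = h (H n \<omega>)" for g :: "_ \<Rightarrow> real" and h n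
    using int_H[of h n] that by (simp cong: Bochner_Integration.integrable_cong)
  have int_Z: "integrable M (\<lambda>\<omega>. Z \<omega> k)" for k
    by (rule int_cong[of _ "\<lambda>s. ?\<phi> (s k) (xh k s) - ?\<phi> (s k) xhat" "Suc k"])
      (simp add: Z_def x_eq[of _ k "Suc k"], simp add: H_def S_def)
  have int_N: "integrable M (\<lambda>\<omega>. N \<omega> k)" for k
    by (rule int_cong[of _ "\<lambda>s. ?\<phi> (s k) xhat - l (s k)" "Suc k"])
      (simp add: N_def H_def S_def)
  have int_F: "integrable M (\<lambda>\<omega>. ?F (x (S \<omega>) k))" for k
    by (rule int_cong[of _ "\<lambda>s. ?F (xh k s)" k]) (simp add: x_eq[of _ k k])
  have xbar_eq: "xbar \<omega> = (\<Sum>k<K. (1 / real K) *\<^sub>R x (S \<omega>) k)" if "\<omega> \<in> space M" for \<omega>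
    using xbar[OF that] by (simp add: S_def scaleR_sum_right)
  have int_bar: "integrable M (\<lambda>\<omega>. ?F (xbar \<omega>))"
    by (rule int_cong[of _ "\<lambda>s. ?F (\<Sum>k<K. (1 / real K) *\<^sub>R xh k s)" K])
      (simp add: xbar_eq x_eq[of _ _ K])

  \<comment> \<open>Means of the block gap and of the noise\<close>
  have EZ: "expectation (\<lambda>\<omega>. Z \<omega> k) = expectation (\<lambda>\<omega>. ?F (x (S \<omega>) k)) - Fbar" for k
  proof -
    have "expectation (\<lambda>\<omega>. Z \<omega> k)
        = expectation (\<lambda>\<omega>. ?\<phi> (J k \<omega>) (xh k (H k \<omega>)) - ?\<phi> (J k \<omega>) xhat)"
      by (rule Bochner_Integration.integral_cong) (auto simp: Z_def x_eq[of _ k k])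
    \<comment> \<open>The history \<open>H k\<close> determines the iterate and is independent of
      \<open>J k\<close>, so the block is averaged at a fixed point.\<close>
    also have "\<dots> = expectation (\<lambda>\<omega>. \<Sum>B\<in>?A. pmf p B * (?\<phi> B (xh k (H k \<omega>)) - ?\<phi> B xhat))"
      using expectation_history[OF J_indep fin_A, of "\<lambda>s B. ?\<phi> B (xh k s) - ?\<phi> B xhat" k]
      by (simp add: H_def S_def J_distr)
    also have "\<dots> = expectation (\<lambda>\<omega>. ?F (x (S \<omega>) k) - ?F xhat)"
    proof (rule Bochner_Integration.integral_cong[OF refl])
      fix \<omega> assume "\<omega> \<in> space M"
      then show "(\<Sum>B\<in>?A. pmf p B * (?\<phi> B (xh k (H k \<omega>)) - ?\<phi> B xhat))
          = ?F (x (S \<omega>) k) - ?F xhat"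
        unfolding x_eq[OF _ order_refl]
        using expected_block_sum[OF p_blocks tau_pos p_marginal, of "\<lambda>i. f i (xh k (H k \<omega>))"]
          expected_block_sum[OF p_blocks tau_pos p_marginal, of "\<lambda>i. f i xhat"]
        by (simp only: x_eq[OF _ order_refl] right_diff_distrib sum_subtractf block_fun_def
            objective_def)
    qed
    finally show ?thesis using int_F by (simp add: Fbar_eq prob_space)
  qed
  have EN: "expectation (\<lambda>\<omega>. N \<omega> k) = \<sigma>2" for k
  proof -
    have "expectation (\<lambda>\<omega>. N \<omega> k) = (\<Sum>B\<in>?A. pmf p B * (?\<phi> B xhat - l B))"
      using expectation_history[OF J_indep fin_A, of "\<lambda>s B. ?\<phi> B xhat - l B" k]
      by (simp add: N_def J_distr prob_space)
    also have "\<dots> = \<sigma>2"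
      unfolding sigma noise_sq_def using p_blocks
      by (subst integral_measure_pmf_real[OF fin_A]) (auto simp: mult.commute)
    finally show ?thesis .
  qed

  \<comment> \<open>Averaging the regret bound\<close>
  have "expectation (\<lambda>\<omega>. \<Sum>k<K. (1 - lam k / 2) * Z \<omega> k - lam k / 2 * N \<omega> k)
      \<le> expectation (\<lambda>\<omega>. C)"
  proof (rule integral_mono_AE)
    show "AE \<omega> in M. (\<Sum>k<K. (1 - lam k / 2) * Z \<omega> k - lam k / 2 * N \<omega> k) \<le> C"
      using J_supp AE_space by eventually_elim (rule regret)
  qed (use int_Z int_N in auto)
  then have EC: "(\<Sum>k<K. (1 - lam k / 2) * expectation (\<lambda>\<omega>. Z \<omega> k) - lam k / 2 * \<sigma>2) \<le> C"
    using int_Z int_N by (simp add: EN prob_space)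
  \<comment> \<open>A single \<open>Z \<omega> k\<close> may be negative, since \<open>xhat\<close>
    minimizes the objective and not necessarily each block. Hence the factor
    \<open>1 - lam k / 2\<close> is lowered to \<open>1 / 2\<close> only after taking
    expectations.\<close>
  have EZ_nonneg: "0 \<le> expectation (\<lambda>\<omega>. Z \<omega> k)" for k
  proof -
    have "expectation (\<lambda>\<omega>. Fbar) \<le> expectation (\<lambda>\<omega>. ?F (x (S \<omega>) k))"
      using int_F F_min by (intro integral_mono) (auto simp: Fbar_eq)
    then show ?thesis by (simp add: EZ prob_space)
  qed
  have "1 / 2 * expectation (\<lambda>\<omega>. Z \<omega> k) \<le> (1 - lam k / 2) * expectation (\<lambda>\<omega>. Z \<omega> k)" for k
    using EZ_nonneg lam(3)[of k] by (intro mult_right_mono) auto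
  then have "(\<Sum>k<K. 1 / 2 * expectation (\<lambda>\<omega>. Z \<omega> k) - lam k / 2 * \<sigma>2) \<le> C"
    by (intro order_trans[OF sum_mono EC] diff_right_mono)
  moreover have "(\<Sum>k<K. 1 / 2 * expectation (\<lambda>\<omega>. Z \<omega> k) - lam k / 2 * \<sigma>2)
      = (\<Sum>k<K. expectation (\<lambda>\<omega>. Z \<omega> k)) / 2 - \<sigma>2 * (\<Sum>k<K. lam k) / 2"
    by (simp add: sum_subtractf sum_divide_distrib sum_distrib_left mult.commute)
  ultimately have sum_EZ: "(\<Sum>k<K. expectation (\<lambda>\<omega>. Z \<omega> k)) \<le> 2 * C + \<sigma>2 * (\<Sum>k<K. lam k)"
    by linarith

  \<comment> \<open>Jensen's inequality for the averaged iterate\<close>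
  have "expectation (\<lambda>\<omega>. ?F (xbar \<omega>) - Fbar)
      \<le> expectation (\<lambda>\<omega>. \<Sum>k<K. (1 / real K) * (?F (x (S \<omega>) k) - Fbar))"
  proof (rule integral_mono)
    fix \<omega> assume \<omega>: "\<omega> \<in> space M"
    have "?F (xbar \<omega>) \<le> (\<Sum>k<K. (1 / real K) * ?F (x (S \<omega>) k))"
      unfolding xbar_eq[OF \<omega>] using K by (intro convex_on_sum[OF _ _ F_convex]) (auto simp: lessThan_empty_iff)
    also have "\<dots> = (\<Sum>k<K. (1 / real K) * (?F (x (S \<omega>) k) - Fbar)) + Fbar"
      using K by (simp only: right_diff_distrib sum_subtractf) simp
    finally show "?F (xbar \<omega>) - Fbar \<le> (\<Sum>k<K. (1 / real K) * (?F (x (S \<omega>) k) - Fbar))"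
      by simp
  qed (use int_bar int_F in auto)
  also have "\<dots> = (\<Sum>k<K. expectation (\<lambda>\<omega>. Z \<omega> k)) / real K"
    using int_F by (simp add: EZ prob_space sum_divide_distrib)
  also have "\<dots> \<le> (2 * C + \<sigma>2 * (\<Sum>k<K. lam k)) / real K"
    using sum_EZ by (intro divide_right_mono) auto
  finally have main: "expectation (\<lambda>\<omega>. ?F (xbar \<omega>) - Fbar)
      \<le> (2 * C + \<sigma>2 * (\<Sum>k<K. lam k)) / real K" .

  \<comment> \<open>Rates for constant and decreasing \<open>lam\<close>\<close>
  show ?thesis
  proof (intro conjI allI impI; elim conjE)
    fix c :: real assume "\<sigma>2 = 0" "c \<ge> 1" "\<forall>k. lam k = 1 / c"
    then have "(2 * C + \<sigma>2 * (\<Sum>k<K. lam k)) / real K = 2 * D * c / (real K * Ltilde)"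
      by (simp add: C_def mult_ac)
    then show "expectation (\<lambda>\<omega>. ?F (xbar \<omega>) - Fbar) \<le> 2 * D * c / (real K * Ltilde)"
      using main by simp
  next
    fix c :: real assume \<sigma>: "\<sigma>2 > 0" and c: "c > 0"
      and lam_eq: "\<forall>k. lam k = 1 / (c * sqrt (real (k + 1)))"
    have "(\<Sum>k<K. lam k) = (\<Sum>k<K. 1 / sqrt (real (k + 1))) / c"
      by (simp add: lam_eq sum_divide_distrib mult.commute)
    also have "\<dots> \<le> 2 * sqrt (real K) / c"
      using sum_inverse_sqrt_le c by (intro divide_right_mono) auto
    finally have "\<sigma>2 * (\<Sum>k<K. lam k) \<le> \<sigma>2 * (2 * sqrt (real K) / c)"
      using \<sigma> by (intro mult_left_mono) auto
    \<comment> \<open>The last index is \<open>K - 1\<close>, so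
      \<open>lam (K - 1) = 1 / (c * sqrt K)\<close> with no shift under the root.\<close>
    moreover have "C = c * D / Ltilde * sqrt (real K)"
      using K by (simp add: C_def lam_eq)
    ultimately have "2 * C + \<sigma>2 * (\<Sum>k<K. lam k)
        \<le> (2 * c * D / Ltilde + 2 * \<sigma>2 / c) * sqrt (real K)"
      by (simp add: algebra_simps)
    then have "(2 * C + \<sigma>2 * (\<Sum>k<K. lam k)) / real K
        \<le> (2 * c * D / Ltilde + 2 * \<sigma>2 / c) * sqrt (real K) / real K"
      by (intro divide_right_mono) auto
    also have "\<dots> = (2 * c * D / Ltilde + 2 * \<sigma>2 / c) / sqrt (real K)"
      unfolding times_divide_eq_right[symmetric] sqrt_divide_self_eq[OF of_nat_0_le_iff]
      by (rule divide_inverse[symmetric])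
    finally show "expectation (\<lambda>\<omega>. ?F (xbar \<omega>) - Fbar)
        \<le> (2 * c * D / Ltilde + 2 * \<sigma>2 / c) / sqrt (real K)"
      using main by simp
  qed
qed

end
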